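(* Let $f\in L^1(a,b)$, with $b>a$ and $a,b\in\mathbb{R}$. Then $$\mathbf{E}^{\gamma}_{\alpha,\beta,\omega,a+}\,f(t)=\sum_{k=0}^{\infty}\frac{(\gamma)_k\,\omega^k}{k!}\,J_{a+}^{\alpha k+\beta}f(t),$$ provided that $\alpha,\beta\in\mathbb{R}^+$ and $\gamma,\omega\in\mathbb{C}$.
   Context: The Pochhammer (rising factorial) symbol is denoted $(\gamma)_k$; it can be rewritten as $(\gamma)_k=\Gamma(\gamma+k)/\Gamma(\gamma)$. The Prabhakar (three-parameter Mittag-Leffler) function is $E^{\gamma}_{\alpha,\beta}(z)=\sum_{k=0}^\infty \frac{(\gamma)_k}{\Gamma(\alpha k+\beta)}\frac{z^k}{k!}$, for $z,\alpha,\beta,\gamma\in\mathbb{C}$ with $\mathrm{Re}(\alpha)>0$. The Prabhakar kernel is $e^{\gamma}_{\alpha,\beta}(\omega;t)=t^{\beta-1}E^{\gamma}_{\alpha,\beta}(\omega t^\alpha)$. The Prabhakar fractional integral of $f\in L^1(a,b)$ is $\mathbf{E}^{\gamma}_{\alpha,\beta,\omega,a+}f(t)=\int_a^t e^{\gamma}_{\alpha,\beta}(\omega;t-\tau)\,f(\tau)\,d\tau$, where $0\le a<t<b\le+\infty$. The Riemann-Liouville fractional integral of order $\sigma\in\mathbb{R}^+$ is $J_{a+}^{\sigma}f(t)=\frac{1}{\Gamma(\sigma)}\int_a^t f(\tau)(t-\tau)^{\sigma-1}\,d\tau$. *)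

theory Defs
  imports "HOL-Analysis.Analysis"
begin

text \<open>
  \<^const>\<open>Gamma\<close> is \<open>0\<close> at its poles, so with \<open>x / 0 = 0\<close> the quotient by
  \<^const>\<open>Gamma\<close> below is multiplication by the entire function \<open>1 / \<Gamma>\<close> for all \<open>\<alpha>, \<beta>\<close>.
\<close>

definition prabhakar :: "complex \<Rightarrow> complex \<Rightarrow> complex \<Rightarrow> complex \<Rightarrow> complex" where
  "prabhakar \<alpha> \<beta> \<gamma> z =
     (\<Sum>k. pochhammer \<gamma> k / Gamma (\<alpha> * of_nat k + \<beta>) * (z ^ k / fact k))"

definition prabhakar_kernel ::
    "complex \<Rightarrow> complex \<Rightarrow> complex \<Rightarrow> complex \<Rightarrow> real \<Rightarrow> complex" where
  "prabhakar_kernel \<alpha> \<beta> \<gamma> \<omega> t =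
     of_real t powr (\<beta> - 1) * prabhakar \<alpha> \<beta> \<gamma> (\<omega> * of_real t powr \<alpha>)"

definition prabhakar_integral ::
    "complex \<Rightarrow> complex \<Rightarrow> complex \<Rightarrow> complex \<Rightarrow> real \<Rightarrow> (real \<Rightarrow> complex) \<Rightarrow> real \<Rightarrow> complex" where
  "prabhakar_integral \<alpha> \<beta> \<gamma> \<omega> a f t =
     (LINT \<tau>:{a<..<t}|lebesgue. prabhakar_kernel \<alpha> \<beta> \<gamma> \<omega> (t - \<tau>) * f \<tau>)"

definition RL_integral :: "real \<Rightarrow> real \<Rightarrow> (real \<Rightarrow> complex) \<Rightarrow> real \<Rightarrow> complex" where
  "RL_integral \<sigma> a f t =
     1 / of_real (Gamma \<sigma>) *
       (LINT \<tau>:{a<..<t}|lebesgue. f \<tau> * of_real ((t - \<tau>) powr (\<sigma> - 1)))"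

text \<open>
  The Lebesgue integral of the library is \<open>0\<close> for non-integrable functions. Since the kernels
  may be singular at \<open>\<tau> = t\<close>, the integrals of an \<open>L\<^sup>1\<close> function need only exist for almost
  every \<open>t\<close>; the following predicates say that they exist at the point \<open>t\<close>.
\<close>

definition prabhakar_integral_exists ::
    "complex \<Rightarrow> complex \<Rightarrow> complex \<Rightarrow> complex \<Rightarrow> real \<Rightarrow> (real \<Rightarrow> complex) \<Rightarrow> real \<Rightarrow> bool" where
  "prabhakar_integral_exists \<alpha> \<beta> \<gamma> \<omega> a f t \<longleftrightarrow>
     set_integrable lebesgue {a<..<t} (\<lambda>\<tau>. prabhakar_kernel \<alpha> \<beta> \<gamma> \<omega> (t - \<tau>) * f \<tau>)"

definition RL_integral_exists :: "real \<Rightarrow> real \<Rightarrow> (real \<Rightarrow> complex) \<Rightarrow> real \<Rightarrow> bool" where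
  "RL_integral_exists \<sigma> a f t \<longleftrightarrow>
     set_integrable lebesgue {a<..<t} (\<lambda>\<tau>. f \<tau> * of_real ((t - \<tau>) powr (\<sigma> - 1)))"

end

theory Submission
  imports Defs
begin

text \<open>
  On \<open>(a, t)\<close> the \<open>k\<close>-th term of the Prabhakar kernel is dominated by
  \<open>\<bar>c\<^sub>k\<bar> (t - a)\<^bsup>\<alpha> k\<^esup> (t - \<tau>)\<^bsup>\<beta> - 1\<^esup>\<close> with summable coefficients, since \<open>\<Gamma>\<close> grows faster than
  every exponential. So all integrals exist at \<open>t\<close>, and integration is termwise, as soon as
  \<open>\<bar>f \<tau>\<bar> (t - \<tau>)\<^bsup>\<beta> - 1\<^esup>\<close> is integrable; by Tonelli's theorem this is the case for almost every \<open>t\<close>.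
\<close>

section \<open>Growth of the Gamma function and decay of the coefficients\<close>

text \<open>The factor \<open>fact k\<close> cancels the factorial in the series, so that only
  geometric growth is left to set against Gamma.\<close>

lemma norm_pochhammer_le:
  fixes \<gamma> :: complex
  shows "norm (pochhammer \<gamma> k) \<le> fact k * (1 + norm \<gamma>) ^ k"
proof (induction k)
  case (Suc k)
  have "norm (\<gamma> + of_nat k) \<le> norm \<gamma> + real k"
    by (metis norm_of_nat norm_triangle_ineq)
  also have "\<dots> \<le> real (Suc k) * (1 + norm \<gamma>)"
    by (simp add: algebra_simps)
  finally have "norm (pochhammer \<gamma> k) * norm (\<gamma> + of_nat k)
      \<le> (fact k * (1 + norm \<gamma>) ^ k) * (real (Suc k) * (1 + norm \<gamma>))"
    using Suc.IH by (intro mult_mono) auto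
  then show ?case
    by (simp only: pochhammer_Suc norm_mult fact_Suc power_Suc mult_ac)
qed simp

text \<open>Euler's integral is restricted to [s, s+1], where each factor of the integrand is
  bounded by its value at an endpoint. As s is free, Gamma outgrows every exponential.\<close>

lemma Gamma_ge_powr:
  fixes s x :: real
  assumes "s > 0" "x \<ge> 1"
  shows "s powr (x - 1) / exp (s + 1) \<le> Gamma x"
proof (rule has_integral_le)
  show "((\<lambda>u. if u \<in> {s..s+1} then s powr (x - 1) / exp (s + 1) else 0)
      has_integral s powr (x - 1) / exp (s + 1)) {0..}"
    using assms has_integral_const_real[of "s powr (x - 1) / exp (s + 1)" s "s + 1"]
    by (subst has_integral_restrict) auto
  show "((\<lambda>t. t powr (x - 1) / exp t) has_integral Gamma x) {0..}"
    using assms by (intro Gamma_integral_real) auto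
  show "(if u \<in> {s..s+1} then s powr (x - 1) / exp (s + 1) else 0) \<le> u powr (x - 1) / exp u" for u
    using assms by (auto intro!: frac_le powr_mono2)
qed

lemma summable_power_div_Gamma:
  fixes \<alpha> \<beta> R :: real
  assumes "\<alpha> > 0" "\<beta> > 0" "R \<ge> 0"
  shows "summable (\<lambda>k. R ^ k / Gamma (\<alpha> * real k + \<beta>))"
proof -
  \<comment> \<open>The choice makes s^\<alpha> twice as large as R, which leaves the ratio 1/2 for
    a geometric comparison; the summand 1 keeps s positive for R = 0.\<close>
  define s where "s = (2 * R + 1) powr (1 / \<alpha>)"
  have s: "s > 0" "s powr \<alpha> = 2 * R + 1"
    using assms by (auto simp: s_def powr_powr)
  \<comment> \<open>This collects the factors of the lower bound for Gamma that do not depend on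
    k.\<close>
  define C where "C = exp (s + 1) / s powr (\<beta> - 1)"
  have "C > 0"
    using s by (simp add: C_def)
  \<comment> \<open>From here on \<alpha> k + \<beta> is at least 1, as the lower bound for Gamma
    requires.\<close>
  have "\<forall>\<^sub>F k in sequentially. real k \<ge> 1 / \<alpha>"
    using filterlim_real_sequentially by (simp add: filterlim_at_top)
  then have "\<forall>\<^sub>F k in sequentially. norm (R ^ k / Gamma (\<alpha> * real k + \<beta>)) \<le> C * (1 / 2) ^ k"
  proof eventually_elim
    case (elim k)
    let ?x = "\<alpha> * real k + \<beta>"
    have x: "?x \<ge> 1"
      using elim assms by (simp add: field_simps)
    have "s powr (?x - 1) = s powr (\<alpha> * real k) * s powr (\<beta> - 1)"
      by (metis add_diff_eq powr_add)
    also have "s powr (\<alpha> * real k) = (2 * R + 1) ^ k"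
      using s assms by (simp add: powr_powr[symmetric] powr_realpow)
    finally have "(2 * R + 1) ^ k / C = s powr (?x - 1) / exp (s + 1)"
      using s by (simp add: C_def)
    also have "\<dots> \<le> Gamma ?x"
      using Gamma_ge_powr s x by blast
    finally have "(2 * R + 1) ^ k / C \<le> Gamma ?x" .
    moreover have "(2 * R) ^ k \<le> (2 * R + 1) ^ k"
      using assms by (intro power_mono) auto
    ultimately have "(2 * R) ^ k \<le> C * Gamma ?x"
      using \<open>C > 0\<close> by (simp add: field_simps)
    moreover have "Gamma ?x > 0"
      using x by simp
    ultimately show ?case
      using assms by (simp add: field_simps power_mult_distrib)
  qed
  then show ?thesis
    by (rule summable_comparison_test_ev) (auto intro: summable_mult summable_geometric)
qed

text \<open>By the Pochhammer bound the terms are at most ((1 + |\<gamma>|) r)^k / Gamma(\<alpha> k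
  + \<beta>). The radius r is arbitrary, so it can later absorb |\<omega>| and a power of t -
  a.\<close>

lemma summable_norm_prabhakar_coeff:
  fixes \<alpha> \<beta> r :: real and \<gamma> :: complex
  assumes "\<alpha> > 0" "\<beta> > 0" "r \<ge> 0"
  shows "summable (\<lambda>k. norm (pochhammer \<gamma> k / of_real (Gamma (\<alpha> * real k + \<beta>)) / fact k) * r ^ k)"
proof (rule summable_comparison_test)
  show "summable (\<lambda>k. ((1 + norm \<gamma>) * r) ^ k / Gamma (\<alpha> * real k + \<beta>))"
    using assms by (intro summable_power_div_Gamma) auto
  have "norm (pochhammer \<gamma> k / of_real (Gamma (\<alpha> * real k + \<beta>)) / fact k) * r ^ k
      \<le> ((1 + norm \<gamma>) * r) ^ k / Gamma (\<alpha> * real k + \<beta>)" for k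
  proof -
    have G: "Gamma (\<alpha> * real k + \<beta>) > 0"
      using assms by (intro Gamma_real_pos add_nonneg_pos) auto
    have "norm (pochhammer \<gamma> k) * r ^ k \<le> (fact k * (1 + norm \<gamma>) ^ k) * r ^ k"
      using assms by (intro mult_right_mono norm_pochhammer_le) auto
    then have "norm (pochhammer \<gamma> k) * r ^ k / (Gamma (\<alpha> * real k + \<beta>) * fact k)
      \<le> (fact k * (1 + norm \<gamma>) ^ k) * r ^ k / (Gamma (\<alpha> * real k + \<beta>) * fact k)"
      using G by (intro divide_right_mono) auto
    then show ?thesis
      using G by (simp add: norm_divide norm_mult power_mult_distrib)
  qed
  then show "\<exists>N. \<forall>k\<ge>N. norm (norm (pochhammer \<gamma> k / of_real (Gamma (\<alpha> * real k + \<beta>)) / fact k) * r ^ k)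
      \<le> ((1 + norm \<gamma>) * r) ^ k / Gamma (\<alpha> * real k + \<beta>)"
    using assms by auto
qed

text \<open>Once the series at z = \<omega> x^\<alpha> is known to converge, the prefactor
  x^(\<beta>-1) can be moved into it; the k-th term then contains the Riemann-Liouville kernel of
  order \<alpha> k + \<beta>.\<close>

lemma prabhakar_kernel_sums:
  fixes \<alpha> \<beta> x :: real and \<gamma> \<omega> :: complex
  assumes "\<alpha> > 0" "\<beta> > 0" "x > 0"
  shows "(\<lambda>k. pochhammer \<gamma> k / of_real (Gamma (\<alpha> * real k + \<beta>)) / fact k * \<omega> ^ k
            * of_real (x powr (\<alpha> * real k + \<beta> - 1)))
          sums prabhakar_kernel (of_real \<alpha>) (of_real \<beta>) \<gamma> \<omega> x"
proof -
  define z where "z = \<omega> * of_real (x powr \<alpha>)"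
  let ?c = "\<lambda>k. pochhammer \<gamma> k / of_real (Gamma (\<alpha> * real k + \<beta>)) / fact k"
  have "summable (\<lambda>k. ?c k * z ^ k)"
    using summable_norm_prabhakar_coeff[OF assms(1,2) norm_ge_zero[of z], of \<gamma>]
    by (intro summable_norm_cancel[of "\<lambda>k. ?c k * z ^ k"]) (simp add: norm_mult norm_divide norm_power)
  moreover have "Gamma (of_real \<alpha> * of_nat k + of_real \<beta>) = complex_of_real (Gamma (\<alpha> * real k + \<beta>))" for k
    by (metis Gamma_complex_of_real of_real_add of_real_mult of_real_of_nat_eq)
  ultimately have "(\<lambda>k. ?c k * z ^ k) sums prabhakar (of_real \<alpha>) (of_real \<beta>) \<gamma> z"
    unfolding prabhakar_def by (simp add: summable_sums)
  then have "(\<lambda>k. of_real (x powr (\<beta> - 1)) * (?c k * z ^ k))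
      sums (of_real (x powr (\<beta> - 1)) * prabhakar (of_real \<alpha>) (of_real \<beta>) \<gamma> z)"
    by (rule sums_mult)
  also have "of_real (x powr (\<beta> - 1)) * prabhakar (of_real \<alpha>) (of_real \<beta>) \<gamma> z
      = prabhakar_kernel (of_real \<alpha>) (of_real \<beta>) \<gamma> \<omega> x"
    using assms powr_of_real[of x "\<beta> - 1"] powr_of_real[of x \<alpha>]
    by (simp add: prabhakar_kernel_def z_def)
  also have "(\<lambda>k. of_real (x powr (\<beta> - 1)) * (?c k * z ^ k))
      = (\<lambda>k. ?c k * \<omega> ^ k * of_real (x powr (\<alpha> * real k + \<beta> - 1)))"
  proof
    fix k
    have "x powr (\<alpha> * real k + \<beta> - 1) = x powr (\<beta> - 1) * x powr (\<alpha> * real k)"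
      by (metis add.commute add_diff_eq powr_add)
    also have "x powr (\<alpha> * real k) = (x powr \<alpha>) ^ k"
      using assms by (simp add: powr_powr[symmetric] powr_realpow)
    finally show "of_real (x powr (\<beta> - 1)) * (?c k * z ^ k)
      = ?c k * \<omega> ^ k * of_real (x powr (\<alpha> * real k + \<beta> - 1))"
      by (simp add: z_def power_mult_distrib)
  qed
  finally show ?thesis .
qed

section \<open>Termwise integration at a fixed point\<close>

context
  fixes f :: "real \<Rightarrow> complex" and a t \<alpha> \<beta> :: real
  assumes \<alpha>: "\<alpha> > 0" and \<beta>: "\<beta> > 0"
    and ex: "RL_integral_exists \<beta> a f t"
begin

text \<open>The normalisation 1/Gamma is left to the coefficients. Extension by zero turns set
  integrals into integrals over the whole line, as the theorems on integrating series
  expect.\<close>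

definition RL_term :: "nat \<Rightarrow> real \<Rightarrow> complex" where
  "RL_term k \<tau> = indicator {a<..<t} \<tau> *\<^sub>R (f \<tau> * of_real ((t - \<tau>) powr (\<alpha> * real k + \<beta> - 1)))"

private lemma RL_term_0: "integrable lebesgue (RL_term 0)"
  using ex by (simp add: RL_term_def[abs_def] RL_integral_exists_def set_integrable_def)

text \<open>Any singularity at \<tau> = t is confined to \<open>RL_term 0\<close>, which is
  integrable by \<open>ex\<close>; the other factor has a nonnegative exponent and is bounded on the
  interval.\<close>

private lemma RL_term_eq:
  "RL_term k \<tau> = of_real ((t - \<tau>) powr (\<alpha> * real k)) * RL_term 0 \<tau>"
proof -
  have "(t - \<tau>) powr (\<alpha> * real k + \<beta> - 1) = (t - \<tau>) powr (\<alpha> * real k) * (t - \<tau>) powr (\<beta> - 1)"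
    by (metis add_diff_eq powr_add)
  then show ?thesis
    by (simp add: RL_term_def)
qed

private lemma norm_RL_term_le: "norm (RL_term k \<tau>) \<le> ((t - a) powr \<alpha>) ^ k * norm (RL_term 0 \<tau>)"
proof (cases "\<tau> \<in> {a<..<t}")
  case True
  have "(t - \<tau>) powr (\<alpha> * real k) \<le> (t - a) powr (\<alpha> * real k)"
    using True \<alpha> by (intro powr_mono2) auto
  also have "\<dots> = ((t - a) powr \<alpha>) ^ k"
    using True by (simp add: powr_powr[symmetric] powr_realpow)
  finally show ?thesis
    unfolding RL_term_eq[of k] by (simp add: norm_mult mult_right_mono)
qed (simp add: RL_term_def)

private lemma integrable_RL_term: "integrable lebesgue (RL_term k)"
proof (rule Bochner_Integration.integrable_bound)
  show "integrable lebesgue (\<lambda>\<tau>. ((t - a) powr \<alpha>) ^ k * norm (RL_term 0 \<tau>))"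
    using RL_term_0 by (intro integrable_mult_right integrable_norm)
  have [measurable]: "RL_term 0 \<in> borel_measurable lebesgue"
    using RL_term_0 by simp
  have [measurable]: "(\<lambda>\<tau>. complex_of_real ((t - \<tau>) powr (\<alpha> * real k))) \<in> borel_measurable lebesgue"
    by (intro measurable_completion) measurable
  show "RL_term k \<in> borel_measurable lebesgue"
    unfolding RL_term_eq[of k, abs_def] by measurable
  show "AE \<tau> in lebesgue. norm (RL_term k \<tau>) \<le> norm (((t - a) powr \<alpha>) ^ k * norm (RL_term 0 \<tau>))"
    using norm_RL_term_le by auto
qed

lemma RL_integral_exists_shift: "RL_integral_exists (\<alpha> * real k + \<beta>) a f t"
  using integrable_RL_term[of k]
  by (simp add: RL_term_def[abs_def] RL_integral_exists_def set_integrable_def)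

text \<open>Interchanging sum and integral requires absolute summability at almost every point and
  summable integrals of the norms. Both follow from one bound, a summable sequence \<open>d\<close>
  times the fixed integrable function |\<open>RL_term 0\<close>|.\<close>

lemma
  shows prabhakar_integral_exists_if_RL:
      "prabhakar_integral_exists (of_real \<alpha>) (of_real \<beta>) \<gamma> \<omega> a f t" (is ?ex)
    and RL_sums_prabhakar_integral:
      "(\<lambda>k. pochhammer \<gamma> k * \<omega> ^ k / fact k * RL_integral (\<alpha> * real k + \<beta>) a f t)
         sums prabhakar_integral (of_real \<alpha>) (of_real \<beta>) \<gamma> \<omega> a f t" (is ?sums)
proof -
  define c where "c k = pochhammer \<gamma> k / of_real (Gamma (\<alpha> * real k + \<beta>)) / fact k * \<omega> ^ k" for k
  define d where "d k = norm (c k) * ((t - a) powr \<alpha>) ^ k" for k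
  define G where "G k \<tau> = c k * RL_term k \<tau>" for k \<tau>
  \<comment> \<open>The coefficient lemma is applied at r = |\<omega>| (t-a)^\<alpha>, which makes
    its terms those of \<open>d\<close>.\<close>
  have "summable (\<lambda>k. norm (pochhammer \<gamma> k / of_real (Gamma (\<alpha> * real k + \<beta>)) / fact k)
      * (norm \<omega> * (t - a) powr \<alpha>) ^ k)"
    using \<alpha> \<beta> by (intro summable_norm_prabhakar_coeff) auto
  then have d: "summable d"
    by (simp add: d_def[abs_def] c_def norm_mult norm_divide norm_power power_mult_distrib mult_ac)
  have G_le: "norm (G k \<tau>) \<le> d k * norm (RL_term 0 \<tau>)" for k \<tau>
    using mult_left_mono[OF norm_RL_term_le[of k \<tau>] norm_ge_zero[of "c k"]]
    by (simp add: G_def d_def norm_mult mult_ac)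
  have int_G: "integrable lebesgue (G k)" for k
    unfolding G_def[abs_def] by (intro integrable_mult_right integrable_RL_term)
  have G_AE: "AE \<tau> in lebesgue. summable (\<lambda>k. norm (G k \<tau>))"
    using G_le d by (intro AE_I2 summable_comparison_test[OF _ summable_mult2[OF d]]) auto
  have "(\<integral>\<tau>. norm (G k \<tau>) \<partial>lebesgue) \<le> d k * (\<integral>\<tau>. norm (RL_term 0 \<tau>) \<partial>lebesgue)" for k
    using G_le int_G RL_term_0 by (subst integral_mult_right_zero[symmetric], intro integral_mono) auto
  then have G_int: "summable (\<lambda>k. \<integral>\<tau>. norm (G k \<tau>) \<partial>lebesgue)"
    by (intro summable_comparison_test[OF _ summable_mult2[OF d]]) auto
  \<comment> \<open>Inside the interval this is the kernel series times f; outside it every term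
    vanishes.\<close>
  have kernel: "(\<lambda>\<tau>. \<Sum>k. G k \<tau>) = (\<lambda>\<tau>. indicator {a<..<t} \<tau> *\<^sub>R
      (prabhakar_kernel (of_real \<alpha>) (of_real \<beta>) \<gamma> \<omega> (t - \<tau>) * f \<tau>))"
  proof
    fix \<tau>
    show "(\<Sum>k. G k \<tau>) = indicator {a<..<t} \<tau> *\<^sub>R
      (prabhakar_kernel (of_real \<alpha>) (of_real \<beta>) \<gamma> \<omega> (t - \<tau>) * f \<tau>)"
    proof (cases "\<tau> \<in> {a<..<t}")
      case True
      then have "(\<lambda>k. c k * of_real ((t - \<tau>) powr (\<alpha> * real k + \<beta> - 1)) * f \<tau>)
          sums (prabhakar_kernel (of_real \<alpha>) (of_real \<beta>) \<gamma> \<omega> (t - \<tau>) * f \<tau>)"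
        unfolding c_def using \<alpha> \<beta> by (intro sums_mult2 prabhakar_kernel_sums) auto
      then show ?thesis
        using True by (simp add: G_def RL_term_def sums_unique[symmetric] mult_ac)
    qed (simp add: G_def RL_term_def)
  qed
  show ?ex
    using integrable_suminf[OF int_G G_AE G_int]
    by (simp add: kernel prabhakar_integral_exists_def set_integrable_def)
  have "integral\<^sup>L lebesgue (G k) = c k * integral\<^sup>L lebesgue (RL_term k)" for k
    by (simp add: G_def[abs_def])
  \<comment> \<open>The factor 1/Gamma passes from \<open>c k\<close> into the normalisation of
    \<open>RL_integral\<close>.\<close>
  then have "integral\<^sup>L lebesgue (G k)
      = pochhammer \<gamma> k * \<omega> ^ k / fact k * RL_integral (\<alpha> * real k + \<beta>) a f t" for k
    by (simp add: c_def RL_integral_def RL_term_def[abs_def] set_lebesgue_integral_def)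
  then show ?sums
    using sums_integral[OF int_G G_AE G_int]
    by (simp add: kernel prabhakar_integral_def set_lebesgue_integral_def)
qed

end

section \<open>Existence of the integrals almost everywhere\<close>

text \<open>By Tonelli and translation invariance the integral of the convolution is the product of
  the two integrals. A function with finite integral is finite almost everywhere.\<close>

lemma AE_nn_convolution_finite:
  fixes g h :: "real \<Rightarrow> ennreal"
  assumes [measurable]: "g \<in> borel_measurable borel" "h \<in> borel_measurable borel"
    and g: "(\<integral>\<^sup>+x. g x \<partial>lborel) < \<infinity>" and h: "(\<integral>\<^sup>+x. h x \<partial>lborel) < \<infinity>"
  shows "AE t in lborel. (\<integral>\<^sup>+\<tau>. g \<tau> * h (t - \<tau>) \<partial>lborel) < \<infinity>"
proof -
  have "(\<integral>\<^sup>+t. (\<integral>\<^sup>+\<tau>. g \<tau> * h (t - \<tau>) \<partial>lborel) \<partial>lborel)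
      = (\<integral>\<^sup>+\<tau>. (\<integral>\<^sup>+t. g \<tau> * h (t - \<tau>) \<partial>lborel) \<partial>lborel)"
    by (rule lborel_pair.Fubini') measurable
  also have "\<dots> = (\<integral>\<^sup>+\<tau>. g \<tau> * (\<integral>\<^sup>+x. h x \<partial>lborel) \<partial>lborel)"
  proof (rule nn_integral_cong)
    fix \<tau> :: real
    have "(\<integral>\<^sup>+t. h (t - \<tau>) \<partial>lborel) = (\<integral>\<^sup>+x. h x \<partial>lborel)"
      using nn_integral_real_affine[of h 1 "- \<tau>"] by simp
    then show "(\<integral>\<^sup>+t. g \<tau> * h (t - \<tau>) \<partial>lborel) = g \<tau> * (\<integral>\<^sup>+x. h x \<partial>lborel)"
      by (simp add: nn_integral_cmult)
  qed
  also have "\<dots> = (\<integral>\<^sup>+x. g x \<partial>lborel) * (\<integral>\<^sup>+x. h x \<partial>lborel)"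
    by (simp add: nn_integral_multc)
  also have "\<dots> < \<infinity>"
    using g h by (simp add: ennreal_mult_less_top)
  finally have "AE t in lborel. (\<integral>\<^sup>+\<tau>. g \<tau> * h (t - \<tau>) \<partial>lborel) \<noteq> \<infinity>"
    by (intro nn_integral_noteq_infinite) auto
  then show ?thesis
    by (simp add: less_top)
qed

text \<open>For t in (a, b) the norm of the integrand is at most that of a convolution integrand,
  with |f| extended by zero and the power x^(\<beta>-1) cut off to a bounded interval.\<close>

lemma AE_RL_integral_exists:
  fixes f :: "real \<Rightarrow> complex" and a b \<beta> :: real
  assumes f: "f absolutely_integrable_on {a<..<b}" and "\<beta> > 0"
  shows "AE t\<in>{a<..<b} in lebesgue. RL_integral_exists \<beta> a f t"
proof (cases "a < b")
  case True
  define F where "F \<tau> = indicator {a<..<b} \<tau> *\<^sub>R f \<tau>" for \<tau>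
  have F: "integrable lebesgue F"
    using f by (simp add: F_def[abs_def] set_integrable_def)
  then have F_meas [measurable]: "F \<in> borel_measurable lebesgue"
    by simp
  then have "(\<lambda>\<tau>. ennreal (norm (F \<tau>))) \<in> borel_measurable (completion lborel)"
    by measurable
  \<comment> \<open>The convolution lemma needs Borel functions, whereas |F| is only Lebesgue
    measurable; a Borel function equal to it almost everywhere takes its place.\<close>
  from completion_ex_borel_measurable[OF this] obtain g where
    g: "g \<in> borel_measurable borel" "AE \<tau> in lborel. ennreal (norm (F \<tau>)) = g \<tau>"
    by auto
  \<comment> \<open>The cutoff [0, b-a] contains every difference t - \<tau> with a < \<tau> < t <
    b, and \<beta> > 0 makes the power integrable at 0.\<close>
  define h where "h x = ennreal (x powr (\<beta> - 1)) * indicator {0..b-a} x" for x :: real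
  have h: "h \<in> borel_measurable borel"
    unfolding h_def[abs_def] by measurable
  have "(\<integral>\<^sup>+x. g x \<partial>lborel) = (\<integral>\<^sup>+\<tau>. ennreal (norm (F \<tau>)) \<partial>lebesgue)"
    unfolding nn_integral_completion using g(2) by (intro nn_integral_cong_AE) auto
  also have "\<dots> < \<infinity>"
    using F by (simp add: integrable_iff_bounded)
  finally have g_fin: "(\<integral>\<^sup>+x. g x \<partial>lborel) < \<infinity>" .
  have "(\<integral>\<^sup>+x. h x \<partial>lborel) = ennreal ((b - a) powr (\<beta> - 1 + 1) / (\<beta> - 1 + 1))"
    unfolding h_def using True \<open>\<beta> > 0\<close>
    by (intro nn_integral_has_integral_lebesgue' has_integral_powr_from_0) auto
  then have h_fin: "(\<integral>\<^sup>+x. h x \<partial>lborel) < \<infinity>"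
    by simp
  have "AE t in lebesgue. (\<integral>\<^sup>+\<tau>. g \<tau> * h (t - \<tau>) \<partial>lborel) < \<infinity>"
    using AE_nn_convolution_finite[OF g(1) h g_fin h_fin] by (rule AE_completion)
  then show ?thesis
  proof eventually_elim
    case (elim t)
    show ?case
    proof
      assume t: "t \<in> {a<..<b}"
      let ?u = "\<lambda>\<tau>. indicator {a<..<t} \<tau> *\<^sub>R (f \<tau> * of_real ((t - \<tau>) powr (\<beta> - 1)))"
      \<comment> \<open>Since (a, t) lies in (a, b), f may be replaced by F, which is measurable on
        the whole line.\<close>
      have u: "?u = (\<lambda>\<tau>. F \<tau> * (indicator {a<..<t} \<tau> *\<^sub>R complex_of_real ((t - \<tau>) powr (\<beta> - 1))))"
        using t by (auto simp: F_def fun_eq_iff split: split_indicator)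
      have [measurable]: "(\<lambda>\<tau>. indicator {a<..<t} \<tau> *\<^sub>R complex_of_real ((t - \<tau>) powr (\<beta> - 1)))
          \<in> borel_measurable lebesgue"
        by (intro measurable_completion) measurable
      have "(\<integral>\<^sup>+\<tau>. ennreal (norm (?u \<tau>)) \<partial>lebesgue) \<le> (\<integral>\<^sup>+\<tau>. ennreal (norm (F \<tau>)) * h (t - \<tau>) \<partial>lebesgue)"
        using t
        by (intro nn_integral_mono)
          (auto simp: F_def h_def norm_mult ennreal_mult split: split_indicator)
      also have "\<dots> = (\<integral>\<^sup>+\<tau>. g \<tau> * h (t - \<tau>) \<partial>lborel)"
        unfolding nn_integral_completion using g(2) by (intro nn_integral_cong_AE) auto
      finally have "(\<integral>\<^sup>+\<tau>. ennreal (norm (?u \<tau>)) \<partial>lebesgue) < \<infinity>"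
        using elim by simp
      moreover have "?u \<in> borel_measurable lebesgue"
        unfolding u by measurable
      ultimately have "integrable lebesgue ?u"
        by (intro integrableI_bounded)
      then show "RL_integral_exists \<beta> a f t"
        by (simp add: RL_integral_exists_def set_integrable_def)
    qed
  qed
qed simp

text \<open>The first conjunct shows that the identity in the second is asserted at almost every t.
  Using \<open>sums\<close> makes convergence of the series part of the claim.\<close>

theorem theorem1:
  fixes f :: "real \<Rightarrow> complex" and a b \<alpha> \<beta> :: real and \<gamma> \<omega> :: complex
  assumes "a < b"
    and "f absolutely_integrable_on {a<..<b}"
    and "\<alpha> > 0" and "\<beta> > 0"
  shows "(AE t\<in>{a<..<b} in lebesgue.
            prabhakar_integral_exists (of_real \<alpha>) (of_real \<beta>) \<gamma> \<omega> a f t \<and>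
            (\<forall>k::nat. RL_integral_exists (\<alpha> * real k + \<beta>) a f t)) \<and>
         (\<forall>t\<in>{a<..<b}.
            prabhakar_integral_exists (of_real \<alpha>) (of_real \<beta>) \<gamma> \<omega> a f t \<and>
            (\<forall>k::nat. RL_integral_exists (\<alpha> * real k + \<beta>) a f t) \<longrightarrow>
            (\<lambda>k::nat. pochhammer \<gamma> k * \<omega> ^ k / fact k * RL_integral (\<alpha> * real k + \<beta>) a f t)
              sums prabhakar_integral (of_real \<alpha>) (of_real \<beta>) \<gamma> \<omega> a f t)"
proof (intro conjI ballI impI)
  show "AE t\<in>{a<..<b} in lebesgue.
      prabhakar_integral_exists (of_real \<alpha>) (of_real \<beta>) \<gamma> \<omega> a f t \<and>
      (\<forall>k::nat. RL_integral_exists (\<alpha> * real k + \<beta>) a f t)"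
    using AE_RL_integral_exists[OF assms(2,4)]
  proof eventually_elim
    case (elim t)
    then show ?case
      using prabhakar_integral_exists_if_RL RL_integral_exists_shift assms(3,4) by blast
  qed
next
  fix t
  assume "prabhakar_integral_exists (of_real \<alpha>) (of_real \<beta>) \<gamma> \<omega> a f t \<and>
      (\<forall>k::nat. RL_integral_exists (\<alpha> * real k + \<beta>) a f t)"
  \<comment> \<open>The instance k = 0 has order \<beta> and supplies the assumption
    \<open>ex\<close> of the termwise integration.\<close>
  then have "RL_integral_exists (\<alpha> * real 0 + \<beta>) a f t"
    by blast
  then show "(\<lambda>k. pochhammer \<gamma> k * \<omega> ^ k / fact k * RL_integral (\<alpha> * real k + \<beta>) a f t)
      sums prabhakar_integral (of_real \<alpha>) (of_real \<beta>) \<gamma> \<omega> a f t"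
    using RL_sums_prabhakar_integral assms(3,4) by simp
qed

end
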